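(* Let $\ell$ be a positive integer, and for $\sigma\in\{0,1\}$ let $\mathsf r^\ell_\sigma(q)=\sum q^{\mathrm{rk}(\boldsymbol\sigma)}$, summed over all $\boldsymbol\sigma\in\mathbb Z^\ell$ with $\sigma_1+\dots+\sigma_\ell=\sigma$. Then $$q\,\mathsf r^\ell_1(q^2)=\sum_{\substack{\sigma_1,\dots,\sigma_\ell\in\mathbb Z\\ \sigma_1+\dots+\sigma_\ell=1}}q^{\sigma_1^2+\dots+\sigma_\ell^2}\qquad\text{and}\qquad \mathsf r^\ell_0(q^2)=\sum_{\substack{\sigma_1,\dots,\sigma_\ell\in\mathbb Z\\ \sigma_1+\dots+\sigma_\ell=0}}q^{\sigma_1^2+\dots+\sigma_\ell^2}.$$
   Context: For $\boldsymbol\sigma=(\sigma_1,\dots,\sigma_\ell)\in\mathbb Z^\ell$, the rank is $\mathrm{rk}(\boldsymbol\sigma)=\left\lceil\frac{Y-\ell+1}{2\ell}\right\rceil$ where $Y=\sum_{i=1}^{\ell}\sum_{j\ne i}\sigma_i(\sigma_i-\sigma_j)$. *)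

theory Defs
  imports "HOL-Analysis.Infinite_Sum" "HOL-Library.FuncSet"
    "HOL-Computational_Algebra.Formal_Power_Series"
begin

text \<open>
  Elements of \<open>\<int>\<close> to the power \<open>l\<close> are functions on \<open>{1..l}\<close>, made extensional (via \<open>\<rightarrow>\<^sub>E\<close>) so
  that each tuple is represented exactly once.
\<close>

definition tuples_with_sum :: "nat \<Rightarrow> int \<Rightarrow> (nat \<Rightarrow> int) set" where
  "tuples_with_sum l s = {\<sigma> \<in> {1..l} \<rightarrow>\<^sub>E UNIV. (\<Sum>i=1..l. \<sigma> i) = s}"

definition tuple_Y :: "nat \<Rightarrow> (nat \<Rightarrow> int) \<Rightarrow> int" where
  "tuple_Y l \<sigma> = (\<Sum>i\<in>{1..l}. \<Sum>j\<in>{1..l} - {i}. \<sigma> i * (\<sigma> i - \<sigma> j))"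

definition rk :: "nat \<Rightarrow> (nat \<Rightarrow> int) \<Rightarrow> int" where
  "rk l \<sigma> = \<lceil>(real_of_int (tuple_Y l \<sigma>) - real l + 1) / (2 * real l)\<rceil>"

text \<open>
  The infinite sum is taken in the \<open>X\<close>-adic topology on \<open>\<int>[[X]]\<close> (the library's metric on \<open>fps\<close>).
  Pitfalls: \<open>nat\<close> would truncate a negative rank, and \<open>infsum\<close> is \<open>0\<close> on a non-summable family.
  So results about this series should be accompanied by nonnegativity of the ranks and summability
  on the index set.
\<close>

definition rank_gf :: "nat \<Rightarrow> int \<Rightarrow> int fps" where
  "rank_gf l s = (\<Sum>\<^sub>\<infinity>\<sigma>\<in>tuples_with_sum l s. fps_X ^ nat (rk l \<sigma>))"

end

theory Submission
  imports Defs
begin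

text \<open>
  Write \<open>N\<close> for the sum of the squares \<open>\<sigma>\<^sub>i\<^sup>2\<close> and \<open>s\<close> for the sum of the \<open>\<sigma>\<^sub>i\<close>. Expanding the double sum
  gives \<open>Y = l N - s\<^sup>2\<close> (lemma \<open>tuple_Y_eq\<close>), and \<open>x\<^sup>2 \<equiv> x (mod 2)\<close> gives \<open>N \<equiv> s (mod 2)\<close>. If
  \<open>s \<in> {0, 1}\<close>, then \<open>N = 2 m + s\<close> for an integer \<open>m\<close>, and the argument of the ceiling in the rank is
  \<open>m - (1 - s) (l - 1) / (2 l)\<close>. The correction lies in \<open>[0, 1/2)\<close>, so the rank is exactly \<open>m\<close>. Hence
  \<open>N = 2 rk + s\<close> (lemma \<open>sum_squares_eq_rk\<close>), and both identities compare the same monomials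
  tuple by tuple.

  What remains is to pass from tuples to the infinite sums. A family of monomials is summable in
  the \<open>X\<close>-adic topology when each exponent occurs finitely often, and the coefficients of its sum
  count the occurrences. This count turns the substitution \<open>X \<mapsto> X\<^sup>2\<close> and the multiplication by \<open>X\<^sup>s\<close>
  into a relabelling of exponents. The exponents \<open>N\<close> occur finitely often because only finitely many
  integer points lie on a sphere, and the ranks inherit this from \<open>N\<close>.
\<close>

text \<open>
  Convergence of formal power series is coefficientwise stabilisation. The coefficient of \<open>X\<^sup>n\<close> in
  a finite partial sum counts the indices with exponent \<open>n\<close>, and it is stable as soon as
  the partial sum contains the whole fibre over \<open>n\<close>.
\<close>

lemma has_sum_fps_X_power:
  fixes e :: "'a \<Rightarrow> nat"
  assumes fin: "\<And>n. finite {a \<in> A. e a = n}"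
  shows "((\<lambda>a. fps_X ^ e a :: int fps) has_sum Abs_fps (\<lambda>n. int (card {a \<in> A. e a = n}))) A"
  unfolding has_sum_def
proof (rule tendsto_fpsI)
  fix n
  show "\<forall>\<^sub>F F in finite_subsets_at_top A.
          fps_nth (\<Sum>a\<in>F. fps_X ^ e a :: int fps) n
            = fps_nth (Abs_fps (\<lambda>n. int (card {a \<in> A. e a = n}))) n"
    unfolding eventually_finite_subsets_at_top
  proof (intro exI[of _ "{a \<in> A. e a = n}"] conjI allI impI)
    fix F assume F: "finite F \<and> {a \<in> A. e a = n} \<subseteq> F \<and> F \<subseteq> A"
    then have "{a \<in> F. n = e a} = {a \<in> A. e a = n}"
      by auto
    then have "(\<Sum>a\<in>F. if n = e a then 1 else 0) = int (card {a \<in> A. e a = n})"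
      using F by (simp add: sum.If_cases Int_def)
    then show "fps_nth (\<Sum>a\<in>F. fps_X ^ e a :: int fps) n
        = fps_nth (Abs_fps (\<lambda>n. int (card {a \<in> A. e a = n}))) n"
      by (simp add: fps_sum_nth)
  qed (use fin in auto)
qed

lemma fps_compose_X_squared_nth:
  fixes f :: "'a::comm_ring_1 fps"
  shows "fps_nth (f oo fps_X ^ 2) n = (if even n then fps_nth f (n div 2) else 0)"
proof -
  have "fps_nth (f oo fps_X ^ 2) n = (\<Sum>i=0..n. if n = 2 * i then fps_nth f i else 0)"
    unfolding fps_compose_nth power_mult[symmetric] by (intro sum.cong) auto
  also have "\<dots> = (\<Sum>i\<in>{0..n} \<inter> {i. n = 2 * i}. fps_nth f i)"
    by (simp add: sum.inter_restrict)
  also have "{0..n} \<inter> {i. n = 2 * i} = (if even n then {n div 2} else {})"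
    by auto
  finally show ?thesis
    by simp
qed

text \<open>
  Both sides have the same coefficients: the fibre of \<open>2 e + s\<close> over \<open>n\<close> is empty
  unless \<open>n - s\<close> is even and nonnegative, and otherwise it is the fibre of \<open>e\<close> over \<open>(n - s) / 2\<close>.
\<close>

lemma infsum_fps_X_power_compose_squared:
  fixes e :: "'a \<Rightarrow> nat"
  assumes fin: "\<And>n. finite {a \<in> A. e a = n}"
  shows "fps_X ^ s * ((\<Sum>\<^sub>\<infinity>a\<in>A. fps_X ^ e a :: int fps) oo fps_X ^ 2)
           = (\<Sum>\<^sub>\<infinity>a\<in>A. fps_X ^ (2 * e a + s))"
proof -
  have fibre: "{a \<in> A. 2 * e a + s = n} =
      (if s \<le> n \<and> even (n - s) then {a \<in> A. e a = (n - s) div 2} else {})" for n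
    by auto
  have "finite {a \<in> A. 2 * e a + s = n}" for n
    unfolding fibre using fin by simp
  from infsumI[OF has_sum_fps_X_power[OF this]] infsumI[OF has_sum_fps_X_power[OF fin]]
  show ?thesis
    by (auto simp: fps_eq_iff fps_X_power_mult_nth fps_compose_X_squared_nth fibre)
qed

text \<open>The diagonal terms \<open>j = i\<close> vanish, so the inner sum may run over all \<open>j\<close>.\<close>

lemma tuple_Y_eq:
  "tuple_Y l \<sigma> = int l * (\<Sum>i=1..l. (\<sigma> i)\<^sup>2) - (\<Sum>i=1..l. \<sigma> i)\<^sup>2"
proof -
  have "tuple_Y l \<sigma> = (\<Sum>i=1..l. \<Sum>j=1..l. \<sigma> i * (\<sigma> i - \<sigma> j))"
    unfolding tuple_Y_def by (intro sum.cong sum.mono_neutral_left) auto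
  also have "\<dots> = (\<Sum>i=1..l. int l * (\<sigma> i)\<^sup>2) - (\<Sum>i=1..l. \<sigma> i * (\<Sum>j=1..l. \<sigma> j))"
    by (simp add: right_diff_distrib sum_subtractf sum_distrib_left power2_eq_square)
  finally show ?thesis
    by (simp add: sum_distrib_left[symmetric] sum_distrib_right[symmetric] power2_eq_square)
qed

lemma sum_squares_eq_rk:
  assumes l: "l > 0" and s: "s \<in> {0, 1}" and \<sigma>: "\<sigma> \<in> tuples_with_sum l s"
  shows "(\<Sum>i=1..l. (\<sigma> i)\<^sup>2) = 2 * rk l \<sigma> + s"
proof -
  define N where "N = (\<Sum>i=1..l. (\<sigma> i)\<^sup>2)"
  have sum: "(\<Sum>i=1..l. \<sigma> i) = s"
    using \<sigma> by (simp add: tuples_with_sum_def)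
  have "N - s = (\<Sum>i=1..l. \<sigma> i * (\<sigma> i - 1))"
    unfolding N_def sum[symmetric]
    by (simp add: sum_subtractf[symmetric] power2_eq_square right_diff_distrib)
  also have "even \<dots>"
    by (intro dvd_sum) auto
  finally obtain m where "N - s = 2 * m"
    by (elim evenE)
  then have m: "N = 2 * m + s"
    by simp
  have Y: "tuple_Y l \<sigma> = int l * (2 * m + s) - s\<^sup>2"
    using tuple_Y_eq[of l \<sigma>] sum m by (simp add: N_def)
  have "rk l \<sigma> = m"
    unfolding rk_def
  proof (rule ceiling_unique)
    show "real_of_int m - 1 < (real_of_int (tuple_Y l \<sigma>) - real l + 1) / (2 * real l)"
      using l s by (auto simp: Y field_simps)
    show "(real_of_int (tuple_Y l \<sigma>) - real l + 1) / (2 * real l) \<le> real_of_int m"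
      using l s by (auto simp: Y field_simps)
  qed
  with m show ?thesis
    by (simp add: N_def)
qed

lemma rk_nonneg:
  assumes "l > 0" "s \<in> {0, 1}" "\<sigma> \<in> tuples_with_sum l s"
  shows "0 \<le> rk l \<sigma>"
proof -
  have "0 \<le> 2 * rk l \<sigma> + s"
    using sum_squares_eq_rk[OF assms] by (metis sum_nonneg zero_le_power2)
  with assms(2) show ?thesis
    by auto
qed

lemma nat_sum_squares_eq_rk:
  assumes "l > 0" "s \<in> {0, 1}" "\<sigma> \<in> tuples_with_sum l s"
  shows "nat (\<Sum>i=1..l. (\<sigma> i)\<^sup>2) = 2 * nat (rk l \<sigma>) + nat s"
  using sum_squares_eq_rk[OF assms] rk_nonneg[OF assms] assms(2) by auto

text \<open>For integers \<open>\<bar>x\<bar> \<le> x\<^sup>2\<close>, so the sphere lies in a finite box.\<close>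

lemma finite_tuples_sum_squares:
  "finite {\<sigma> \<in> tuples_with_sum l s. nat (\<Sum>i=1..l. (\<sigma> i)\<^sup>2) = n}"
proof (rule finite_subset)
  show "finite ({1..l} \<rightarrow>\<^sub>E {- int n..int n})"
    by (intro finite_PiE) auto
  show "{\<sigma> \<in> tuples_with_sum l s. nat (\<Sum>i=1..l. (\<sigma> i)\<^sup>2) = n} \<subseteq> {1..l} \<rightarrow>\<^sub>E {- int n..int n}"
  proof
    fix \<sigma> assume "\<sigma> \<in> {\<sigma> \<in> tuples_with_sum l s. nat (\<Sum>i=1..l. (\<sigma> i)\<^sup>2) = n}"
    then have ext: "\<sigma> \<in> {1..l} \<rightarrow>\<^sub>E UNIV" and n: "nat (\<Sum>i=1..l. (\<sigma> i)\<^sup>2) = n"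
      by (auto simp: tuples_with_sum_def)
    have "\<sigma> i \<in> {- int n..int n}" if "i \<in> {1..l}" for i
    proof -
      have "\<bar>\<sigma> i\<bar> \<le> \<bar>\<sigma> i\<bar> ^ 2"
        using self_le_power[of "\<bar>\<sigma> i\<bar>" 2] by (cases "\<sigma> i = 0") auto
      also have "\<dots> \<le> (\<Sum>i=1..l. (\<sigma> i)\<^sup>2)"
        using member_le_sum[of i "{1..l}" "\<lambda>i. (\<sigma> i)\<^sup>2"] that by simp
      also have "\<dots> \<le> int n"
        using n by linarith
      finally show ?thesis
        by auto
    qed
    with ext show "\<sigma> \<in> {1..l} \<rightarrow>\<^sub>E {- int n..int n}"
      by (auto simp: PiE_iff)
  qed
qed

lemma finite_tuples_rk:
  assumes "l > 0" "s \<in> {0, 1}"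
  shows "finite {\<sigma> \<in> tuples_with_sum l s. nat (rk l \<sigma>) = n}"
  by (rule finite_subset[OF _ finite_tuples_sum_squares[of l s "2 * n + nat s"]])
     (auto simp: nat_sum_squares_eq_rk[OF assms] simp del: One_nat_def)

lemma rank_gf_compose_squared:
  assumes "l > 0" "s \<in> {0, 1}"
  shows "fps_X ^ nat s * (rank_gf l s oo fps_X ^ 2)
           = (\<Sum>\<^sub>\<infinity>\<sigma>\<in>tuples_with_sum l s. fps_X ^ nat (\<Sum>i=1..l. (\<sigma> i)\<^sup>2))"
  unfolding rank_gf_def infsum_fps_X_power_compose_squared[OF finite_tuples_rk[OF assms]]
  by (intro infsum_cong) (simp add: nat_sum_squares_eq_rk[OF assms] del: One_nat_def)

theorem lemma4p3:
  fixes l :: nat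
  assumes "l > 0"
  shows "(\<forall>s\<in>{0, 1}.
            (\<forall>\<sigma>\<in>tuples_with_sum l s. 0 \<le> rk l \<sigma>) \<and>
            (\<lambda>\<sigma>. fps_X ^ nat (rk l \<sigma>) :: int fps) summable_on tuples_with_sum l s \<and>
            (\<lambda>\<sigma>. fps_X ^ nat (\<Sum>i=1..l. (\<sigma> i)\<^sup>2) :: int fps) summable_on tuples_with_sum l s) \<and>
         fps_X * (rank_gf l 1 oo fps_X ^ 2)
           = (\<Sum>\<^sub>\<infinity>\<sigma>\<in>tuples_with_sum l 1. fps_X ^ nat (\<Sum>i=1..l. (\<sigma> i)\<^sup>2)) \<and>
         rank_gf l 0 oo fps_X ^ 2
           = (\<Sum>\<^sub>\<infinity>\<sigma>\<in>tuples_with_sum l 0. fps_X ^ nat (\<Sum>i=1..l. (\<sigma> i)\<^sup>2))"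
proof (intro conjI ballI)
  fix s :: int assume s: "s \<in> {0, 1}"
  show "0 \<le> rk l \<sigma>" if "\<sigma> \<in> tuples_with_sum l s" for \<sigma>
    using assms s that by (rule rk_nonneg)
  show "(\<lambda>\<sigma>. fps_X ^ nat (rk l \<sigma>) :: int fps) summable_on tuples_with_sum l s"
    using has_sum_fps_X_power[OF finite_tuples_rk[OF assms s]] by (rule has_sum_imp_summable)
  show "(\<lambda>\<sigma>. fps_X ^ nat (\<Sum>i=1..l. (\<sigma> i)\<^sup>2) :: int fps) summable_on tuples_with_sum l s"
    using has_sum_fps_X_power[OF finite_tuples_sum_squares] by (rule has_sum_imp_summable)
next
  show "fps_X * (rank_gf l 1 oo fps_X ^ 2)
      = (\<Sum>\<^sub>\<infinity>\<sigma>\<in>tuples_with_sum l 1. fps_X ^ nat (\<Sum>i=1..l. (\<sigma> i)\<^sup>2))"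
    using rank_gf_compose_squared[OF assms, of 1] by simp
  show "rank_gf l 0 oo fps_X ^ 2
      = (\<Sum>\<^sub>\<infinity>\<sigma>\<in>tuples_with_sum l 0. fps_X ^ nat (\<Sum>i=1..l. (\<sigma> i)\<^sup>2))"
    using rank_gf_compose_squared[OF assms, of 0] by simp
qed

end
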